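(* Suppose that $\mathbb{X}$ is finite, $f:\mathbb{X}\to\mathbb{Y}^*$ is complete fix-free with $f(\mathbb{X})\ne\{\lambda\}$, and $\nu$ is an AMS measure on $(\mathbb{Y}^{\mathbb{Z}},\mathcal{Y}^{\mathbb{Z}})$. Then $\mu=\nu\circ f^{\mathbb{Z}}$, i.e. $\mu(A)=\nu(f^{\mathbb{Z}}(A))$, is AMS on $(\mathbb{X}^{\mathbb{Z}},\mathcal{X}^{\mathbb{Z}})$ with the stationary mean satisfying $\bar\mu\ll\bar\nu\circ f^{\mathbb{Z}}$.
   Context: $\mathbb{Y}$ is a finite alphabet of cardinality $|\mathbb{Y}|$; $\mathbb{Y}^+$ is the set of nonempty finite strings over $\mathbb{Y}$, $\mathbb{Y}^*=\mathbb{Y}^+\cup\{\lambda\}$ with $\lambda$ the empty string; $|w|$ is the length of a string $w$. $(\mathbb{X}^{\mathbb{Z}},\mathcal{X}^{\mathbb{Z}})$, $(\mathbb{Y}^{\mathbb{Z}},\mathcal{Y}^{\mathbb{Z}})$ are the spaces of two-sided sequences with product $\sigma$-algebras; "measure" means probability measure; $T((x_i)_{i\in\mathbb{Z}})=(x_{i+1})_{i\in\mathbb{Z}}$ is the shift. A measure $\mu$ is asymptotically mean stationary (AMS) if $\bar\mu(A)=\lim_{n\to\infty}\frac1n\sum_{i=0}^{n-1}\mu(T^{-i}A)$ exists for every measurable $A$; $\bar\mu$ is then a stationary probability measure called the stationary mean of $\mu$. $\mu\ll\tau$ means $\tau(A)=0$ implies $\mu(A)=0$. A set $\mathcal{L}\subset\mathbb{Y}^*$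 is prefix-free if $w\ne zs$ for all $w,z\in\mathcal{L}$, $s\in\mathbb{Y}^+$; suffix-free if $w\neq sz$ for all $w,z\in\mathcal{L}$, $s\in\mathbb{Y}^+$; fix-free if it is both; complete if $\sum_{w\in\mathcal{L}}|\mathbb{Y}|^{-|w|}=1$. A function $f:\mathbb{X}\to\mathbb{Y}^*$ is complete fix-free if $f$ is an injection and $f(\mathbb{X})$ is complete and fix-free. $f^{\mathbb{Z}}(x^{\mathbb{Z}})=\dots f(x_{-1})f(x_0)\mathbf{.}f(x_1)f(x_2)\dots$ is the two-sided concatenation ($f(x_1)$ starts at coordinate $1$); under these hypotheses it is a map $\mathbb{X}^{\mathbb{Z}}\to\mathbb{Y}^{\mathbb{Z}}$. *)

theory Defs
  imports "HOL-Probability.Probability"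
begin

definition seq_space :: "(int \<Rightarrow> 'a) measure" where
  "seq_space = PiM UNIV (\<lambda>_. count_space UNIV)"

definition seq_shift :: "(int \<Rightarrow> 'a) \<Rightarrow> int \<Rightarrow> 'a" where
  "seq_shift x = (\<lambda>i. x (i + 1))"

definition shift_average :: "(int \<Rightarrow> 'a) measure \<Rightarrow> (int \<Rightarrow> 'a) set \<Rightarrow> nat \<Rightarrow> real" where
  "shift_average M A n = (\<Sum>i<n. measure M ((seq_shift ^^ i) -` A \<inter> space M)) / real n"

definition AMS :: "(int \<Rightarrow> 'a) measure \<Rightarrow> bool" where
  "AMS M \<longleftrightarrow> (\<forall>A\<in>sets M. convergent (shift_average M A))"

(* By the Vitali-Hahn-Saks theorem the setwise limit is countably additive when M is an AMS
   probability measure.  In general, measure_of returns the zero measure if the given set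
   function is not a measure, so "prob_space (stationary_mean M)" entails that stationary_mean M
   is given by the limits on all of sets M. *)
definition stationary_mean :: "(int \<Rightarrow> 'a) measure \<Rightarrow> (int \<Rightarrow> 'a) measure" where
  "stationary_mean M =
     measure_of (space M) (sets M) (\<lambda>A. ennreal (lim (shift_average M A)))"

definition prefix_free :: "'y list set \<Rightarrow> bool" where
  "prefix_free L \<longleftrightarrow> (\<forall>w\<in>L. \<forall>z\<in>L. \<forall>s. s \<noteq> [] \<longrightarrow> w \<noteq> z @ s)"

definition suffix_free :: "'y list set \<Rightarrow> bool" where
  "suffix_free L \<longleftrightarrow> (\<forall>w\<in>L. \<forall>z\<in>L. \<forall>s. s \<noteq> [] \<longrightarrow> w \<noteq> s @ z)"

definition fix_free :: "'y list set \<Rightarrow> bool" where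
  "fix_free L \<longleftrightarrow> prefix_free L \<and> suffix_free L"

definition complete_code :: "'y::finite list set \<Rightarrow> bool" where
  "complete_code L \<longleftrightarrow> ((\<lambda>w. 1 / real CARD('y) ^ length w) has_sum 1) L"

definition complete_fix_free :: "('x \<Rightarrow> 'y::finite list) \<Rightarrow> bool" where
  "complete_fix_free f \<longleftrightarrow> inj f \<and> complete_code (range f) \<and> fix_free (range f)"

(* Coordinate at which the block f (x i) starts in the two-sided concatenation: block 1 starts at
   coordinate 1, and block i + 1 starts length (f (x i)) coordinates after block i.
   The first sum is empty for i \<le> 1, the second one for i \<ge> 1. *)
definition block_start :: "('x \<Rightarrow> 'y list) \<Rightarrow> (int \<Rightarrow> 'x) \<Rightarrow> int \<Rightarrow> int" where
  "block_start f x i =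
     1 + (\<Sum>j\<in>{1..<i}. int (length (f (x j)))) - (\<Sum>j\<in>{i..0}. int (length (f (x j))))"

(* Coordinate k lies in exactly one block whenever infinitely many blocks on either side of the
   origin are nonempty; the value is unspecified otherwise. *)
definition concat_two_sided :: "('x \<Rightarrow> 'y list) \<Rightarrow> (int \<Rightarrow> 'x) \<Rightarrow> int \<Rightarrow> 'y" where
  "concat_two_sided f x k =
     (let i = (THE i. block_start f x i \<le> k \<and> k < block_start f x (i + 1))
      in f (x i) ! nat (k - block_start f x i))"

(* The set function A \<mapsto> M (f\<^sup>Z(A)).  As for stationary_mean, measure_of returns the zero
   measure if this is not a measure. *)
definition comp_concat ::
  "(int \<Rightarrow> 'y) measure \<Rightarrow> ('x \<Rightarrow> 'y list) \<Rightarrow> (int \<Rightarrow> 'x) measure" where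
  "comp_concat M f =
     measure_of (space seq_space) (sets seq_space) (\<lambda>A. emeasure M (concat_two_sided f ` A))"

end

theory Submission
  imports Defs
begin

text \<open>Let \<open>F\<close> be the two-sided concatenation. Since the code is complete and prefix-free, equality in
Kraft's inequality says that every sequence begins, to the right of the origin, with a codeword;
suffix-freeness gives a codeword that ends at the origin (lemmas \<open>complete_prefix_free_exhaustive\<close>
and \<open>complete_suffix_free_exhaustive\<close>). Reading on in both directions shows that \<open>F\<close> is a bijection with a
measurable inverse \<open>decode\<close>, and therefore \<open>\<nu> \<circ> F\<close> is the distribution of \<open>decode\<close> under \<open>\<nu>\<close>. Under
this bijection the shift of source sequences becomes the map \<open>S = next_word\<close>, which skips the codeword
after the origin.

The stationary mean \<open>m\<close> of \<open>\<nu>\<close> is a probability measure by a gliding hump argument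
(\<open>setwise_limit_continuous_at_empty\<close>), and it is invariant under all translations. The map \<open>S\<close> is a
bijection that translates pieces of the space, so it preserves \<open>m\<close>
(\<open>measure_preserving_next_word\<close>). Moreover \<open>\<nu>\<close> is absolutely continuous with respect to \<open>m\<close>, because the
shift is invertible: a set that is null for \<open>m\<close> stays null when it is saturated by translations, and on
invariant sets \<open>\<nu>\<close> and \<open>m\<close> coincide (\<open>absolutely_continuous_stationary_mean\<close>).

It remains to average \<open>\<nu>\<close> along \<open>S\<close>, which preserves the dominating measure \<open>m\<close>. The averages of an
indicator function along \<open>S\<close> are Cauchy in \<open>L\<^sup>2(m)\<close> by the mean ergodic theorem, and a bounded sequence with this property has convergent integrals against any density
(\<open>convergent_averages_absolutely_continuous\<close>). Hence \<open>\<nu> \<circ> F\<close> is AMS. If \<open>F(A)\<close> is null for \<open>m\<close>, then so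
are all its preimages under powers of \<open>S\<close>; all terms of the averages vanish, and so does the stationary
mean of \<open>\<nu> \<circ> F\<close> on \<open>A\<close>.\<close>

section \<open>Stationary means of AMS measures\<close>

text \<open>The part of the Vitali--Hahn--Saks theorem that makes a setwise limit of measures countably
additive. The proof is a gliding hump: if \<open>l (A i)\<close> stayed above some \<open>\<delta> > 0\<close>, then for
suitable times \<open>n\<^sub>j\<close> nearly all of the mass \<open>\<delta>\<close> would sit in a block
\<open>C\<^sub>j = A (k\<^sub>j) - A (k\<^sub>j\<^sub>+\<^sub>1)\<close>, with disjoint blocks for different \<open>j\<close>. The union
of the even blocks then has large mass at even times and small mass at odd times, so that its mass
does not converge. Phrased for set functions, the lemma applies to averages of measures of preimages
without first turning them into measures.\<close>

lemma setwise_limit_continuous_at_empty: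
  fixes m :: "nat \<Rightarrow> 'a set \<Rightarrow> real"
  assumes "sigma_algebra \<Omega> \<Sigma>"
    and nonneg: "\<And>n A. A \<in> \<Sigma> \<Longrightarrow> 0 \<le> m n A"
    and add: "\<And>n A B. A \<in> \<Sigma> \<Longrightarrow> B \<in> \<Sigma> \<Longrightarrow> A \<inter> B = {} \<Longrightarrow> m n (A \<union> B) = m n A + m n B"
    and cont: "\<And>n A. range A \<subseteq> \<Sigma> \<Longrightarrow> decseq A \<Longrightarrow> (\<Inter>i. A i) = {} \<Longrightarrow> (\<lambda>i. m n (A i)) \<longlonglongrightarrow> 0"
    and lim: "\<And>A. A \<in> \<Sigma> \<Longrightarrow> (\<lambda>n. m n A) \<longlonglongrightarrow> l A"
    and A: "range A \<subseteq> \<Sigma>" "decseq A" "(\<Inter>i. A i) = {}"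
  shows "(\<lambda>i. l (A i)) \<longlonglongrightarrow> 0"
proof -
  interpret sigma_algebra \<Omega> \<Sigma> by fact
  have A_in [simp]: "A i \<in> \<Sigma>" for i using A(1) by auto
  have m_mono: "m n B \<le> m n C" if "B \<in> \<Sigma>" "C \<in> \<Sigma>" "B \<subseteq> C" for n B C
  proof -
    have "m n (B \<union> (C - B)) = m n B + m n (C - B)"
      using that by (intro add) auto
    moreover have "B \<union> (C - B) = C" using that by auto
    ultimately show ?thesis using nonneg[of "C - B" n] that by auto
  qed
  have l_nonneg: "0 \<le> l (A i)" for i
    by (rule LIMSEQ_le_const[OF lim[OF A_in]]) (use nonneg[OF A_in] in auto)
  have dec: "decseq (\<lambda>i. l (A i))"
  proof (rule decseq_SucI)
    fix i
    show "l (A (Suc i)) \<le> l (A i)"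
      using m_mono[OF A_in A_in, of "Suc i" i] A(2)
      by (intro LIMSEQ_le[OF lim[OF A_in] lim[OF A_in]]) (auto simp: decseq_Suc_iff)
  qed
  then obtain \<delta> where \<delta>: "(\<lambda>i. l (A i)) \<longlonglongrightarrow> \<delta>" "\<And>i. \<delta> \<le> l (A i)"
    using decseq_convergent[of "\<lambda>i. l (A i)" 0] l_nonneg by auto
  have "0 \<le> \<delta>" by (rule LIMSEQ_le_const[OF \<delta>(1)]) (auto intro: l_nonneg)
  moreover have False if "\<delta> > 0"
  proof -
    \<comment> \<open>The masses at even times will be at least \<open>\<delta> - 2 * \<eta>\<close> and those at odd times at most
        \<open>3 * \<eta>\<close>; any \<open>\<eta> < \<delta> / 5\<close> separates these bounds.\<close>
    define \<eta> where "\<eta> = \<delta> / 8"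
    have \<eta>: "\<eta> > 0" "\<delta> = 8 * \<eta>" using that by (auto simp: \<eta>_def)
    have "eventually (\<lambda>i. l (A i) < \<delta> + \<eta>) sequentially"
      using \<delta>(1) \<eta>(1) by (intro order_tendstoD) auto
    then obtain K where K: "l (A K) < \<delta> + \<eta>" by (auto simp: eventually_sequentially)
    \<comment> \<open>A state \<open>(k, n)\<close> is followed by a later time \<open>n\<close> that sees the mass of the old \<open>A k\<close>, and then by a
        later \<open>k\<close> beyond which that time sees almost nothing.\<close>
    define R where "R = (\<lambda>(p::nat \<times> nat) (p'::nat \<times> nat). fst p < fst p' \<and> snd p < snd p' \<and>
      m (snd p') (A (fst p)) > \<delta> - \<eta> \<and> m (snd p') (A K) < \<delta> + \<eta> \<and> m (snd p') (A (fst p')) < \<eta>)"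
    have "\<exists>p'. K \<le> fst p' \<and> R p p'" if "K \<le> fst p" for p
    proof -
      obtain k n where p: "p = (k, n)" by (cases p)
      have "eventually (\<lambda>n'. n' > n \<and> m n' (A k) > \<delta> - \<eta> \<and> m n' (A K) < \<delta> + \<eta>) sequentially"
        using eventually_gt_at_top[of n] order_tendstoD(1)[OF lim, of "A k" "\<delta> - \<eta>"]
          order_tendstoD(2)[OF lim, of "A K" "\<delta> + \<eta>"] K \<delta>(2)[of k] \<eta>
        by (intro eventually_conj) auto
      then obtain n' where n': "n' > n" "m n' (A k) > \<delta> - \<eta>" "m n' (A K) < \<delta> + \<eta>"
        by (auto simp: eventually_sequentially)
      have "eventually (\<lambda>k'. k' > k \<and> m n' (A k') < \<eta>) sequentially"
        using cont[OF A] \<eta>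
        by (intro eventually_conj eventually_gt_at_top order_tendstoD(2)) auto
      then obtain k' where "k' > k" "m n' (A k') < \<eta>"
        by (auto simp: eventually_sequentially)
      with n' that show ?thesis
        by (intro exI[of _ "(k', n')"]) (auto simp: R_def p)
    qed
    then obtain s where s: "\<And>j. K \<le> fst (s j)" "\<And>j. R (s j) (s (Suc j))"
      using dependent_nat_choice[of "\<lambda>_ p. K \<le> fst p" "\<lambda>_. R"] by (metis fst_conv order_refl)
    define k where "k = (\<lambda>j. fst (s j))"
    define n where "n = (\<lambda>j. snd (s (Suc j)))"
    have k_step: "k j < k (Suc j)" and n_step: "n j < n (Suc j)"
      and hump: "m (n j) (A (k j)) > \<delta> - \<eta>" and head: "m (n j) (A K) < \<delta> + \<eta>"
      and tail: "m (n j) (A (k (Suc j))) < \<eta>" for j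
      using s(2)[of j] s(2)[of "Suc j"] by (auto simp: R_def k_def n_def)
    have n_mono: "strict_mono n" using n_step by (simp add: strict_mono_Suc_iff)
    have k_mono: "strict_mono k" using k_step by (simp add: strict_mono_Suc_iff)
    have k_ge: "K \<le> k j" for j using s by (simp add: k_def)
    define C where "C = (\<lambda>j. A (k j) - A (k (Suc j)))"
    have C_in [simp]: "C j \<in> \<Sigma>" for j by (auto simp: C_def)
    have C_sub: "C j \<subseteq> A K" for j
      using k_ge[of j] A(2) by (auto simp: C_def decseq_def)
    have C_disj: "C i \<inter> C j = {}" if "i < j" for i j
    proof -
      have "k (Suc i) \<le> k j" using that k_mono by (simp add: strict_mono_less_eq)
      then have "A (k j) \<subseteq> A (k (Suc i))" using A(2) by (auto simp: decseq_def)
      then show ?thesis by (auto simp: C_def)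
    qed
    have C_large: "m (n j) (C j) > \<delta> - 2 * \<eta>" for j
    proof -
      have sub: "A (k (Suc j)) \<subseteq> A (k j)"
        using A(2) k_step[of j] by (simp add: decseq_def)
      have "m (n j) (C j \<union> A (k (Suc j))) = m (n j) (C j) + m (n j) (A (k (Suc j)))"
        by (intro add) (auto simp: C_def)
      moreover have "C j \<union> A (k (Suc j)) = A (k j)" using sub by (auto simp: C_def)
      ultimately show ?thesis using hump[of j] tail[of j] by simp
    qed
    define E where "E = (\<Union>j. C (2 * j))"
    have E_in: "E \<in> \<Sigma>" by (auto simp: E_def)
    have even_large: "6 * \<eta> \<le> m (n (2 * j)) E" for j
    proof -
      have "C (2 * j) \<subseteq> E" unfolding E_def by blast
      from m_mono[OF C_in E_in this, of "n (2 * j)"] C_large[of "2 * j"] \<eta>(2)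
      show ?thesis by linarith
    qed
    have odd_small: "m (n (2 * j + 1)) E \<le> 3 * \<eta>" for j
    proof -
      let ?n = "n (2 * j + 1)" and ?C = "C (2 * j + 1)"
      have "C (2 * i) \<inter> ?C = {}" for i
        using C_disj[of "2 * i" "2 * j + 1"] C_disj[of "2 * j + 1" "2 * i"]
        by (cases "i \<le> j") auto
      then have "m ?n (E \<union> ?C) = m ?n E + m ?n ?C"
        using E_in by (intro add) (auto simp: E_def)
      moreover have "m ?n (E \<union> ?C) \<le> m ?n (A K)"
        using E_in C_sub by (intro m_mono) (auto simp: E_def)
      ultimately show ?thesis using C_large[of "2 * j + 1"] head[of "2 * j + 1"] \<eta> by simp
    qed
    have "(\<lambda>j. m (n (2 * j)) E) \<longlonglongrightarrow> l E"
      using LIMSEQ_subseq_LIMSEQ[OF lim[OF E_in], of "\<lambda>j. n (2 * j)"] n_mono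
      by (auto simp: strict_mono_def o_def)
    then have "6 * \<eta> \<le> l E" by (rule LIMSEQ_le_const) (use even_large in auto)
    moreover have "(\<lambda>j. m (n (2 * j + 1)) E) \<longlonglongrightarrow> l E"
      using LIMSEQ_subseq_LIMSEQ[OF lim[OF E_in], of "\<lambda>j. n (2 * j + 1)"] n_mono
      by (auto simp: strict_mono_def o_def)
    then have "l E \<le> 3 * \<eta>" by (rule LIMSEQ_le_const2) (use odd_small in auto)
    ultimately show False using \<eta>(1) by linarith
  qed
  ultimately have "\<delta> = 0" by force
  with \<delta>(1) show ?thesis by simp
qed

lemma space_seq_space [simp]: "space seq_space = UNIV"
  by (simp add: seq_space_def space_PiM)

lemma seq_shift_funpow: "(seq_shift ^^ n) x = (\<lambda>i. x (i + int n))"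
  by (induction n arbitrary: x) (auto simp: seq_shift_def algebra_simps funpow_swap1)

lemma measurable_seq_spaceI:
  assumes "\<And>i. (\<lambda>y. g y i) \<in> measurable M (count_space UNIV)"
  shows "g \<in> measurable M seq_space"
  unfolding seq_space_def using assms by (intro measurable_PiM_single') (auto simp: space_PiM)

lemma measurable_coordinate: "(\<lambda>x. x i) \<in> measurable seq_space (count_space UNIV)"
  unfolding seq_space_def by (rule measurable_component_singleton) auto

lemma measurable_translate: "(\<lambda>x i. x (i + k)) \<in> measurable seq_space seq_space"
  by (intro measurable_seq_spaceI measurable_coordinate)

lemma measurable_seq_shift_funpow: "(seq_shift ^^ n) \<in> measurable seq_space seq_space"
  using measurable_translate[of "int n"] by (simp add: seq_shift_funpow[abs_def])

lemma seq_shift_funpow_vimage_sets: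
  assumes "sets M = sets seq_space" "A \<in> sets M"
  shows "(seq_shift ^^ n) -` A \<in> sets M"
  using measurable_sets[OF measurable_seq_shift_funpow, of A n] assms by simp

lemma sets_stationary_mean [simp]: "sets (stationary_mean M) = sets M"
  by (simp add: stationary_mean_def)

lemma space_stationary_mean [simp]: "space (stationary_mean M) = space M"
  by (simp add: stationary_mean_def)

text \<open>The shift averages converge on every measurable set by assumption, so the previous lemma makes
their limit a measure; without it \<^const>\<open>stationary_mean\<close> could be the default zero measure.\<close>

lemma stationary_mean_AMS:
  assumes "prob_space M" and sets: "sets M = sets seq_space" and "AMS M"
  shows prob_space_stationary_mean: "prob_space (stationary_mean M)"
    and measure_stationary_mean:
      "A \<in> sets M \<Longrightarrow> measure (stationary_mean M) A = lim (shift_average M A)"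
proof -
  interpret prob_space M by fact
  have sp: "space M = UNIV" using sets_eq_imp_space_eq[OF sets] by simp
  note vim = seq_shift_funpow_vimage_sets[OF sets]
  let ?l = "\<lambda>A. lim (shift_average M A)"
  have nonneg: "0 \<le> shift_average M A n" for A n
    by (simp add: shift_average_def sum_nonneg)
  have add: "shift_average M (A \<union> B) n = shift_average M A n + shift_average M B n"
    if "A \<in> sets M" "B \<in> sets M" "A \<inter> B = {}" for A B n
  proof -
    have "measure M ((seq_shift ^^ i) -` (A \<union> B)) =
        measure M ((seq_shift ^^ i) -` A) + measure M ((seq_shift ^^ i) -` B)" for i
      using that vim by (subst finite_measure_Union[symmetric]) auto
    then show ?thesis by (simp add: shift_average_def sp sum.distrib add_divide_distrib)
  qed
  have cont: "(\<lambda>i. shift_average M (A i) n) \<longlonglongrightarrow> 0"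
    if "range A \<subseteq> sets M" "decseq A" "(\<Inter>i. A i) = {}" for A :: "nat \<Rightarrow> _" and n
  proof -
    have "(\<lambda>i. measure M ((seq_shift ^^ j) -` A i)) \<longlonglongrightarrow> 0" for j
    proof -
      have "decseq (\<lambda>i. (seq_shift ^^ j) -` A i)"
        using that(2) by (intro decseq_SucI vimage_mono) (simp add: decseq_Suc_iff)
      then have "(\<lambda>i. measure M ((seq_shift ^^ j) -` A i)) \<longlonglongrightarrow> measure M (\<Inter>i. (seq_shift ^^ j) -` A i)"
        using that(1) vim by (intro finite_Lim_measure_decseq) auto
      also have "(\<Inter>i. (seq_shift ^^ j) -` A i) = {}" using that(3) by auto
      finally show ?thesis by simp
    qed
    then show ?thesis unfolding shift_average_def sp
      by (auto intro!: tendsto_eq_intros tendsto_null_sum tendsto_divide_zero)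
  qed
  have lim: "shift_average M A \<longlonglongrightarrow> ?l A" if "A \<in> sets M" for A
    using \<open>AMS M\<close> that by (simp add: AMS_def convergent_LIMSEQ_iff)
  have l_nonneg: "0 \<le> ?l A" if "A \<in> sets M" for A
    by (rule LIMSEQ_le_const[OF lim[OF that]]) (auto intro: nonneg)
  have l_add: "?l (A \<union> B) = ?l A + ?l B" if "A \<in> sets M" "B \<in> sets M" "A \<inter> B = {}" for A B
  proof (rule LIMSEQ_unique[OF lim])
    show "shift_average M (A \<union> B) \<longlonglongrightarrow> ?l A + ?l B"
      using tendsto_add[OF lim[OF that(1)] lim[OF that(2)]] by (simp add: add[OF that, symmetric])
  qed (use that in auto)
  have l_empty: "?l {} = 0"
    using l_add[of "{}" "{}"] by simp
  have ca: "countably_additive (sets M) (\<lambda>A. ennreal (?l A))"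
  proof (rule sets.empty_continuous_imp_countably_additive)
    show "positive (sets M) (\<lambda>A. ennreal (?l A))" by (simp add: positive_def l_empty)
    show "additive (sets M) (\<lambda>A. ennreal (?l A))"
      by (auto simp: additive_def l_add l_nonneg)
    fix A :: "nat \<Rightarrow> _" assume A: "range A \<subseteq> sets M" "decseq A" "(\<Inter>i. A i) = {}"
    have "(\<lambda>i. ?l (A i)) \<longlonglongrightarrow> 0"
      by (rule setwise_limit_continuous_at_empty[where m = "\<lambda>n A. shift_average M A n",
            OF sets.sigma_algebra_axioms nonneg add cont lim A])
    then have "(\<lambda>i. ennreal (?l (A i))) \<longlonglongrightarrow> ennreal 0" by (rule tendsto_ennrealI)
    then show "(\<lambda>i. ennreal (?l (A i))) \<longlonglongrightarrow> 0" by simp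
  qed auto
  have em: "emeasure (stationary_mean M) A = ennreal (?l A)" if "A \<in> sets M" for A
    unfolding stationary_mean_def using ca that
    by (subst emeasure_measure_of_sigma)
       (auto simp: positive_def l_empty sets.sigma_algebra_axioms)
  then show "measure (stationary_mean M) A = ?l A" if "A \<in> sets M"
    using that l_nonneg by (simp add: measure_def)
  have "shift_average M (space M) \<longlonglongrightarrow> 1"
  proof (rule tendsto_eventually)
    show "eventually (\<lambda>n. shift_average M (space M) n = 1) sequentially"
      using prob_space by (intro eventually_mono[OF eventually_gt_at_top[of 0]])
        (simp add: shift_average_def sp)
  qed
  then have "?l (space M) = 1" by (rule limI)
  then show "prob_space (stationary_mean M)"
    by (intro prob_spaceI) (simp add: em)
qed

lemma shift_average_LIMSEQ_stationary_mean:
  assumes "prob_space M" "sets M = sets seq_space" "AMS M" "A \<in> sets M"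
  shows "shift_average M A \<longlonglongrightarrow> measure (stationary_mean M) A"
  using assms by (simp add: measure_stationary_mean AMS_def convergent_LIMSEQ_iff)

text \<open>Shifting the set changes the average over \<open>n\<close> terms by a telescoping sum, hence by at most
\<open>1 / n\<close>. The shift is invertible, so invariance extends to translations in both directions.\<close>

lemma measure_stationary_mean_translate:
  assumes "prob_space M" and sets: "sets M = sets seq_space" and "AMS M" and A: "A \<in> sets M"
  shows "measure (stationary_mean M) ((\<lambda>x i. x (i + k)) -` A) = measure (stationary_mean M) A"
proof -
  interpret prob_space M by fact
  have sp: "space M = UNIV" using sets_eq_imp_space_eq[OF sets] by simp
  have vim: "(\<lambda>x i. x (i + k)) -` A \<in> sets M" if "A \<in> sets M" for k A
    using measurable_sets[OF measurable_translate, of A k] that sets by simp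
  note lim = shift_average_LIMSEQ_stationary_mean[OF assms(1-3)]
  have one: "measure (stationary_mean M) (seq_shift -` A) = measure (stationary_mean M) A"
    if A: "A \<in> sets M" for A
  proof -
    have A': "seq_shift -` A \<in> sets M" using seq_shift_funpow_vimage_sets[OF sets A, of 1] by simp
    have diff: "shift_average M (seq_shift -` A) n - shift_average M A n =
        (measure M ((seq_shift ^^ n) -` A) - measure M A) / real n" for n
    proof -
      have "(\<Sum>i<n. measure M ((seq_shift ^^ i) -` seq_shift -` A)) =
          (\<Sum>i<n. measure M ((seq_shift ^^ Suc i) -` A))"
        by (simp add: vimage_comp)
      also have "\<dots> = (\<Sum>i<n. measure M ((seq_shift ^^ i) -` A)) +
          (measure M ((seq_shift ^^ n) -` A) - measure M A)"
        by (induction n) (auto simp: vimage_comp)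
      finally show ?thesis
        by (simp add: shift_average_def sp add_divide_distrib)
    qed
    have "(\<lambda>n. shift_average M (seq_shift -` A) n - shift_average M A n) \<longlonglongrightarrow> 0"
      unfolding diff
    proof (rule Lim_null_comparison)
      show "\<forall>\<^sub>F n in sequentially. norm ((measure M ((seq_shift ^^ n) -` A) - measure M A) / real n)
          \<le> 1 / real n"
      proof (intro always_eventually allI)
        fix n
        have "\<bar>prob ((seq_shift ^^ n) -` A) - prob A\<bar> \<le> 1"
          using prob_le_1[of A] prob_le_1[of "(seq_shift ^^ n) -` A"]
            measure_nonneg[of M A] measure_nonneg[of M "(seq_shift ^^ n) -` A"] by linarith
        then show "norm ((prob ((seq_shift ^^ n) -` A) - prob A) / real n) \<le> 1 / real n"
          by (simp add: divide_right_mono)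
      qed
      show "(\<lambda>n. 1 / real n) \<longlonglongrightarrow> 0" by (rule lim_1_over_n)
    qed
    moreover have "(\<lambda>n. shift_average M (seq_shift -` A) n - shift_average M A n) \<longlonglongrightarrow>
        measure (stationary_mean M) (seq_shift -` A) - measure (stationary_mean M) A"
      by (intro tendsto_diff lim A A')
    ultimately show ?thesis using LIMSEQ_unique by fastforce
  qed
  have nat: "measure (stationary_mean M) ((\<lambda>x i. x (i + int n)) -` A) = measure (stationary_mean M) A"
    if "A \<in> sets M" for n A
  proof (induction n)
    case (Suc n)
    have "(\<lambda>x i. x (i + int (Suc n))) -` A = seq_shift -` (\<lambda>x i. x (i + int n)) -` A"
      by (auto simp: seq_shift_def algebra_simps)
    then show ?case using one[OF vim[OF that]] Suc by simp
  qed simp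
  show ?thesis
  proof (cases "k \<ge> 0")
    case True
    then show ?thesis using nat[OF A, of "nat k"] by simp
  next
    case False
    have "(\<lambda>x i. x (i + int (nat (- k)))) -` (\<lambda>x i. x (i + k)) -` A = A"
      using False by (simp add: vimage_def)
    then show ?thesis using nat[OF vim[OF A], of "nat (- k)" k] by simp
  qed
qed

text \<open>Absolute continuity of an AMS measure with respect to its stationary mean depends on the shift
being invertible: a null set of the stationary mean has a null saturation under all integer
translations, and on an invariant set the averages are constant, so that both measures agree there.
For one-sided sequences the statement fails: the point mass at \<open>1000\<dots>\<close> has the point mass at
\<open>000\<dots>\<close> as its stationary mean.\<close>

lemma absolutely_continuous_stationary_mean:
  assumes "prob_space M" and sets: "sets M = sets seq_space" and "AMS M"
  shows "absolutely_continuous (stationary_mean M) M"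
  unfolding absolutely_continuous_def
proof
  interpret prob_space M by fact
  interpret m: prob_space "stationary_mean M" by (rule prob_space_stationary_mean) fact+
  have sp: "space M = UNIV" using sets_eq_imp_space_eq[OF sets] by simp
  fix A assume A: "A \<in> null_sets (stationary_mean M)"
  then have A_in: "A \<in> sets M" by auto
  define B where "B = (\<Union>k. (\<lambda>x i. x (i + k)) -` A)"
  have vim: "(\<lambda>x i. x (i + k)) -` A \<in> sets M" for k
    using measurable_sets[OF measurable_translate, of A k] A_in sets by simp
  have "(\<lambda>x i. x (i + k)) -` A \<in> null_sets (stationary_mean M)" for k
    using measure_stationary_mean_translate[OF assms A_in, of k] A vim[of k]
    by (auto simp: null_sets_def m.emeasure_eq_measure)
  then have B_null: "B \<in> null_sets (stationary_mean M)"
    unfolding B_def by (intro null_sets_UN) auto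
  have "(seq_shift ^^ n) -` B = B" for n
  proof -
    have "x \<in> (seq_shift ^^ n) -` B \<longleftrightarrow> x \<in> B" for x
    proof -
      have "x \<in> (seq_shift ^^ n) -` B \<longleftrightarrow> (\<exists>k. (\<lambda>i. x (i + (k + int n))) \<in> A)"
        by (simp add: B_def seq_shift_funpow add.assoc)
      also have "\<dots> \<longleftrightarrow> (\<exists>k. (\<lambda>i. x (i + k)) \<in> A)"
        by (metis diff_add_cancel)
      finally show ?thesis by (simp add: B_def)
    qed
    then show ?thesis by blast
  qed
  then have "eventually (\<lambda>n. shift_average M B n = measure M B) sequentially"
    by (intro eventually_mono[OF eventually_gt_at_top[of 0]]) (simp add: shift_average_def sp)
  then have "shift_average M B \<longlonglongrightarrow> measure M B" by (rule tendsto_eventually)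
  moreover have "shift_average M B \<longlonglongrightarrow> measure (stationary_mean M) B"
    using B_null by (intro shift_average_LIMSEQ_stationary_mean assms) auto
  ultimately have "measure M B = 0"
    using B_null LIMSEQ_unique by (fastforce simp: null_sets_def measure_def)
  moreover have "A \<subseteq> B" by (auto simp: B_def intro!: exI[of _ 0])
  moreover have "B \<in> sets M" using B_null by auto
  ultimately show "A \<in> null_sets M"
    using A_in null_sets_subset[of B M A] by (auto simp: emeasure_eq_measure null_sets_def)
qed

section \<open>A mean ergodic theorem\<close>

text \<open>Convergence of ergodic averages is needed only when they are integrated against a probability
measure that is absolutely continuous with respect to the invariant one. For this it is enough that
the averages of a bounded function are Cauchy in \<open>L\<^sup>2\<close>, which follows from F. Riesz's argument:
the averages form a minimizing sequence for the norm on the convex hull of the orbit, and a minimizing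
sequence in a convex set is Cauchy by the parallelogram law. Only numerical integrals occur, so that
no Hilbert space of classes of functions has to be built.\<close>

definition orbit_average :: "('a \<Rightarrow> 'a) \<Rightarrow> ('a \<Rightarrow> real) \<Rightarrow> nat \<Rightarrow> 'a \<Rightarrow> real" where
  "orbit_average S f n x = (\<Sum>i<n. f ((S ^^ i) x)) / real n"

text \<open>The convex hull of the functions \<open>f \<circ> S\<^sup>i\<close>. Generating it by binary combinations lets the estimates for
its elements be proved by rule induction.\<close>

inductive_set orbit_hull :: "('a \<Rightarrow> 'a) \<Rightarrow> ('a \<Rightarrow> real) \<Rightarrow> ('a \<Rightarrow> real) set"
  for S f where
  orbit: "(\<lambda>x. f ((S ^^ i) x)) \<in> orbit_hull S f"
| mix: "h \<in> orbit_hull S f \<Longrightarrow> h' \<in> orbit_hull S f \<Longrightarrow> 0 \<le> t \<Longrightarrow> t \<le> 1 \<Longrightarrow>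
    (\<lambda>x. t * h x + (1 - t) * h' x) \<in> orbit_hull S f"

lemma orbit_average_in_hull: "orbit_average S f (Suc n) \<in> orbit_hull S f"
proof (induction n)
  case 0
  show ?case using orbit_hull.orbit[where i = 0 and S = S and f = f] by (simp add: orbit_average_def[abs_def])
next
  case (Suc n)
  have "orbit_average S f (Suc (Suc n)) = (\<lambda>x. (real (Suc n) / real (Suc (Suc n))) *
      orbit_average S f (Suc n) x + (1 - real (Suc n) / real (Suc (Suc n))) * f ((S ^^ Suc n) x))"
    
  proof
    fix x
    have "orbit_average S f (Suc (Suc n)) x =
        (\<Sum>i<Suc n. f ((S ^^ i) x)) / real (Suc (Suc n)) + f ((S ^^ Suc n) x) / real (Suc (Suc n))"
      by (simp add: orbit_average_def add_divide_distrib)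
    moreover have "(\<Sum>i<Suc n. f ((S ^^ i) x)) = real (Suc n) * orbit_average S f (Suc n) x"
      by (simp add: orbit_average_def)
    moreover have "1 - real (Suc n) / real (Suc (Suc n)) = 1 / real (Suc (Suc n))"
      by (simp add: field_simps)
    ultimately show "orbit_average S f (Suc (Suc n)) x = (real (Suc n) / real (Suc (Suc n))) *
        orbit_average S f (Suc n) x + (1 - real (Suc n) / real (Suc (Suc n))) * f ((S ^^ Suc n) x)"
      by simp
  qed
  moreover have "\<dots> \<in> orbit_hull S f"
    by (intro orbit_hull.mix Suc orbit_hull.orbit) (auto simp: field_simps)
  ultimately show ?case by metis
qed

lemma convex_combination_abs_le:
  fixes a b :: real
  assumes "\<bar>a\<bar> \<le> c" "\<bar>b\<bar> \<le> d" "0 \<le> t" "t \<le> 1"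
  shows "\<bar>t * a + (1 - t) * b\<bar> \<le> t * c + (1 - t) * d"
proof -
  have "\<bar>t * a\<bar> \<le> t * c" "\<bar>(1 - t) * b\<bar> \<le> (1 - t) * d"
    using assms by (simp_all add: abs_mult mult_left_mono)
  then show ?thesis by linarith
qed

lemma orbit_hull_bounded:
  assumes "h \<in> orbit_hull S f" "\<And>x. \<bar>f x\<bar> \<le> B"
  shows "\<bar>h x\<bar> \<le> B"
  using assms(1)
proof induction
  case (mix h h' t)
  then show ?case using convex_combination_abs_le[of "h x" B "h' x" B t] by (simp add: algebra_simps)
qed (use assms(2) in auto)

text \<open>Averaging cannot tell the elements of the hull apart: the orbit sums of \<open>f \<circ> S\<^sup>j\<close> and of \<open>f\<close> differ
in at most \<open>2 j\<close> terms, whatever their length. This is why the norms of the averages of \<open>f\<close> fall to the infimum over the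
whole hull.\<close>

lemma orbit_hull_average_close:
  assumes "h \<in> orbit_hull S f" and B: "\<And>x. \<bar>f x\<bar> \<le> B"
  shows "\<exists>C. \<forall>n x. \<bar>(\<Sum>i<n. h ((S ^^ i) x)) - (\<Sum>i<n. f ((S ^^ i) x))\<bar> \<le> C"
  using assms(1)
proof induction
  case (orbit j)
  have "\<bar>(\<Sum>i<n. f ((S ^^ j) ((S ^^ i) x))) - (\<Sum>i<n. f ((S ^^ i) x))\<bar> \<le> 2 * B * real j" for n x
  proof -
    define g where "g = (\<lambda>k. f ((S ^^ k) x))"
    have g_bd: "\<bar>g k\<bar> \<le> B" for k by (simp add: g_def B)
    have "\<bar>(\<Sum>i<n. g (j + i)) - (\<Sum>i<n. g i)\<bar> \<le> 2 * B * real j"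
    proof (induction j)
      case (Suc j)
      have "(\<Sum>i<n. g (Suc j + i)) - (\<Sum>i<n. g (j + i)) = g (j + n) - g j"
        by (induction n) auto
      then show ?case using Suc g_bd[of "j + n"] g_bd[of j] by (simp add: algebra_simps)
    qed simp
    then show ?thesis by (simp add: g_def funpow_add)
  qed
  then show ?case by blast
next
  case (mix h h' t)
  obtain C C' where C: "\<And>n x. \<bar>(\<Sum>i<n. h ((S ^^ i) x)) - (\<Sum>i<n. f ((S ^^ i) x))\<bar> \<le> C"
    "\<And>n x. \<bar>(\<Sum>i<n. h' ((S ^^ i) x)) - (\<Sum>i<n. f ((S ^^ i) x))\<bar> \<le> C'"
    using mix.IH by blast
  have "\<bar>(\<Sum>i<n. t * h ((S ^^ i) x) + (1 - t) * h' ((S ^^ i) x)) - (\<Sum>i<n. f ((S ^^ i) x))\<bar>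
      \<le> t * C + (1 - t) * C'" for n x
    using convex_combination_abs_le[OF C(1)[of x n] C(2)[of x n] mix.hyps(3,4)]
    unfolding sum.distrib sum_distrib_left[symmetric] by (simp add: algebra_simps)
  then show ?case by blast
qed

locale measure_preserving = prob_space M for M :: "'a measure" +
  fixes S :: "'a \<Rightarrow> 'a"
  assumes S_measurable [measurable]: "S \<in> measurable M M"
    and distr_S: "distr M M S = M"
begin

lemma S_funpow_measurable [measurable]: "(S ^^ i) \<in> measurable M M"
  by (rule measurable_compose_n) (rule S_measurable)

lemma distr_S_funpow: "distr M M (S ^^ i) = M"
proof (induction i)
  case 0
  show ?case by (simp add: distr_id2 id_def)
next
  case (Suc i)
  have "distr M M (S ^^ Suc i) = distr (distr M M (S ^^ i)) M S"
    by (simp add: distr_distr o_def)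
  then show ?case by (simp add: Suc distr_S del: funpow.simps)
qed

lemma orbit_hull_measurable:
  assumes "h \<in> orbit_hull S f" and [measurable]: "f \<in> borel_measurable M"
  shows "h \<in> borel_measurable M"
  using assms(1) by induction auto

lemma orbit_average_measurable [measurable]:
  assumes [measurable]: "f \<in> borel_measurable M"
  shows "orbit_average S f n \<in> borel_measurable M"
  unfolding orbit_average_def[abs_def] by measurable

lemma integrable_square:
  assumes "h \<in> borel_measurable M" "\<And>x. \<bar>h x\<bar> \<le> B"
  shows "integrable M (\<lambda>x. (h x :: real)\<^sup>2)"
proof (rule integrable_const_bound[where B = "B\<^sup>2"])
  have "(h x)\<^sup>2 \<le> B\<^sup>2" for x
    using assms(2)[of x] by (metis abs_le_square_iff abs_of_nonneg abs_ge_zero order_trans)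
  then show "AE x in M. norm ((h x)\<^sup>2) \<le> B\<^sup>2" by simp
qed (use assms in measurable)

lemma orbit_average_bounded:
  assumes "\<And>x. \<bar>f x\<bar> \<le> B"
  shows "\<bar>orbit_average S f n x\<bar> \<le> B"
proof (cases n)
  case 0
  then show ?thesis using order_trans[OF abs_ge_zero assms[of x]] by (simp add: orbit_average_def)
next
  case (Suc k)
  then show ?thesis using orbit_hull_bounded[OF orbit_average_in_hull assms] by simp
qed

text \<open>Averaging is a contraction: Cauchy--Schwarz bounds the square of a mean by the mean of the squares,
and all terms of the latter have the same integral.\<close>

lemma orbit_average_square_le:
  fixes h :: "'a \<Rightarrow> real"
  assumes [measurable]: "h \<in> borel_measurable M" and B: "\<And>x. \<bar>h x\<bar> \<le> B"
  shows "(\<integral>x. (orbit_average S h n x)\<^sup>2 \<partial>M) \<le> (\<integral>x. (h x)\<^sup>2 \<partial>M)"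
proof (cases "n = 0")
  case False
  have pt: "(orbit_average S h n x)\<^sup>2 \<le> (\<Sum>i<n. (h ((S ^^ i) x))\<^sup>2) / real n" for x
  proof -
    have "(\<Sum>i<n. h ((S ^^ i) x))\<^sup>2 \<le> real n * (\<Sum>i<n. (h ((S ^^ i) x))\<^sup>2)"
      using sum_squared_le_sum_of_squares[of "\<lambda>i. h ((S ^^ i) x)" "{..<n}"]
      by (simp add: mult.commute)
    then have "(\<Sum>i<n. h ((S ^^ i) x))\<^sup>2 / (real n)\<^sup>2 \<le>
        real n * (\<Sum>i<n. (h ((S ^^ i) x))\<^sup>2) / (real n)\<^sup>2"
      by (rule divide_right_mono) simp
    also have "\<dots> = (\<Sum>i<n. (h ((S ^^ i) x))\<^sup>2) / real n"
      using False by (simp add: power2_eq_square)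
    finally show ?thesis by (simp only: orbit_average_def power_divide)
  qed
  have int: "integrable M (\<lambda>x. (h ((S ^^ i) x))\<^sup>2)" for i
    using B by (intro integrable_square) auto
  have inv: "(\<integral>x. (h ((S ^^ i) x))\<^sup>2 \<partial>M) = (\<integral>x. (h x)\<^sup>2 \<partial>M)" for i
    using integral_distr[of "S ^^ i" M M "\<lambda>x. (h x)\<^sup>2"] by (simp add: distr_S_funpow)
  have "(\<integral>x. (orbit_average S h n x)\<^sup>2 \<partial>M) \<le> (\<integral>x. (\<Sum>i<n. (h ((S ^^ i) x))\<^sup>2) / real n \<partial>M)"
    using int by (intro integral_mono pt integrable_square[where B = B]
        orbit_average_bounded B integrable_divide Bochner_Integration.integrable_sum) auto
  also have "\<dots> = (\<integral>x. (h x)\<^sup>2 \<partial>M)"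
    using False int inv by (simp add: Bochner_Integration.integral_sum)
  finally show ?thesis .
qed (simp add: orbit_average_def)

text \<open>With \<open>d\<close> the infimum of \<open>\<integral> h\<^sup>2\<close> over the hull, an almost minimal \<open>h\<close> shows that the averages of \<open>f\<close>
satisfy \<open>\<integral> a\<^sub>n\<^sup>2 \<le> d + o(1)\<close>. The midpoint of \<open>a\<^sub>n\<close> and \<open>a\<^sub>m\<close> lies in the hull, and so the parallelogram
identity leaves \<open>\<integral> (a\<^sub>n - a\<^sub>m)\<^sup>2 \<le> 2 (d + o(1)) + 2 (d + o(1)) - 4 d\<close>.\<close>

lemma mean_ergodic_Cauchy:
  fixes f :: "'a \<Rightarrow> real"
  assumes f [measurable]: "f \<in> borel_measurable M" and B: "\<And>x. \<bar>f x\<bar> \<le> B" and "0 < \<epsilon>"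
  shows "\<exists>N. \<forall>n\<ge>N. \<forall>m\<ge>N. (\<integral>x. (orbit_average S f n x - orbit_average S f m x)\<^sup>2 \<partial>M) < \<epsilon>"
proof -
  let ?a = "orbit_average S f" and ?H = "orbit_hull S f"
  define d where "d = (INF h\<in>?H. \<integral>x. (h x)\<^sup>2 \<partial>M)"
  have ne: "?H \<noteq> {}" using orbit_hull.orbit by blast
  have bdd: "bdd_below ((\<lambda>h. \<integral>x. (h x)\<^sup>2 \<partial>M) ` ?H)" by (rule bdd_belowI[of _ 0]) auto
  have B0: "0 \<le> B" using order_trans[OF abs_ge_zero B] .
  have d_le: "d \<le> (\<integral>x. (h x)\<^sup>2 \<partial>M)" if "h \<in> ?H" for h
    unfolding d_def using bdd that by (rule cINF_lower)
  note int = integrable_square[where B = B]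
  obtain h where h: "h \<in> ?H" "(\<integral>x. (h x)\<^sup>2 \<partial>M) < d + \<epsilon> / 8"
    using cINF_less_iff[OF ne bdd, of "d + \<epsilon> / 8"] \<open>0 < \<epsilon>\<close> by (auto simp: d_def)
  note h_meas [measurable] = orbit_hull_measurable[OF h(1) f]
  note h_bd = orbit_hull_bounded[OF h(1) B]
  obtain C where C: "\<And>n x. \<bar>(\<Sum>i<n. h ((S ^^ i) x)) - (\<Sum>i<n. f ((S ^^ i) x))\<bar> \<le> C"
    using orbit_hull_average_close[OF h(1) B] by blast
  have upper: "(\<integral>x. (?a n x)\<^sup>2 \<partial>M) \<le> d + \<epsilon> / 8 + 2 * B * C / real n" for n
  proof -
    have pt: "(?a n x)\<^sup>2 \<le> (orbit_average S h n x)\<^sup>2 + 2 * B * C / real n" for x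
    proof -
      let ?b = "orbit_average S h n x"
      have "\<bar>?a n x - ?b\<bar> \<le> C / real n"
      proof -
        have "?a n x - ?b = ((\<Sum>i<n. f ((S ^^ i) x)) - (\<Sum>i<n. h ((S ^^ i) x))) / real n"
          by (simp add: orbit_average_def diff_divide_distrib)
        then show ?thesis using C[of x n] by (simp add: abs_minus_commute divide_right_mono)
      qed
      moreover have "\<bar>?a n x + ?b\<bar> \<le> 2 * B"
        using orbit_average_bounded[of f B n x, OF B] orbit_average_bounded[of h B n x, OF h_bd]
        by linarith
      ultimately have "\<bar>?a n x - ?b\<bar> * \<bar>?a n x + ?b\<bar> \<le> C / real n * (2 * B)"
        by (intro mult_mono) auto
      moreover have "(?a n x)\<^sup>2 - ?b\<^sup>2 \<le> \<bar>(?a n x - ?b) * (?a n x + ?b)\<bar>"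
        by (simp add: power2_eq_square algebra_simps)
      ultimately show ?thesis by (simp add: abs_mult mult_ac)
    qed
    have "(\<integral>x. (?a n x)\<^sup>2 \<partial>M) \<le> (\<integral>x. (orbit_average S h n x)\<^sup>2 + 2 * B * C / real n \<partial>M)"
      by (intro integral_mono pt int orbit_average_bounded B h_bd
          Bochner_Integration.integrable_add) auto
    also have "\<dots> = (\<integral>x. (orbit_average S h n x)\<^sup>2 \<partial>M) + 2 * B * C / real n"
      by (subst Bochner_Integration.integral_add)
         (auto intro!: int orbit_average_bounded B h_bd simp: prob_space)
    finally show ?thesis
      using orbit_average_square_le[OF h_meas h_bd, of n] h(2) by linarith
  qed
  have "(\<lambda>n. 2 * B * C / real n) \<longlonglongrightarrow> 0" by (rule lim_const_over_n)
  then have "eventually (\<lambda>n. 2 * B * C / real n < \<epsilon> / 8 \<and> 0 < n) sequentially"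
    using \<open>0 < \<epsilon>\<close> by (intro eventually_conj order_tendstoD(2) eventually_gt_at_top) auto
  then obtain N where N: "\<And>n. n \<ge> N \<Longrightarrow> 2 * B * C / real n < \<epsilon> / 8 \<and> 0 < n"
    by (auto simp: eventually_sequentially)
  have "(\<integral>x. (?a n x - ?a m x)\<^sup>2 \<partial>M) < \<epsilon>" if nm: "n \<ge> N" "m \<ge> N" for n m
  proof -
    have hull: "?a n \<in> ?H" "?a m \<in> ?H"
      using orbit_average_in_hull[of S f "n - 1"] orbit_average_in_hull[of S f "m - 1"] N nm by auto
    \<comment> \<open>The weights are written so as to match the convex combinations that generate the hull.\<close>
    let ?c = "\<lambda>x. (1/2) * ?a n x + (1 - 1/2) * ?a m x"
    have c: "?c \<in> ?H" using hull by (intro orbit_hull.mix) auto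
    have "(\<integral>x. (?a n x - ?a m x)\<^sup>2 \<partial>M) = (\<integral>x. 2 * (?a n x)\<^sup>2 + 2 * (?a m x)\<^sup>2 - 4 * (?c x)\<^sup>2 \<partial>M)"
      by (intro Bochner_Integration.integral_cong refl) (simp add: power2_eq_square algebra_simps)
    also have "\<dots> = 2 * (\<integral>x. (?a n x)\<^sup>2 \<partial>M) + 2 * (\<integral>x. (?a m x)\<^sup>2 \<partial>M) - 4 * (\<integral>x. (?c x)\<^sup>2 \<partial>M)"
    proof -
      have "integrable M (\<lambda>x. (?a n x)\<^sup>2)" "integrable M (\<lambda>x. (?a m x)\<^sup>2)" "integrable M (\<lambda>x. (?c x)\<^sup>2)"
        using orbit_hull_measurable[OF c f] orbit_hull_bounded[OF c B]
        by (auto intro!: int orbit_average_bounded B)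
      then show ?thesis by simp
    qed
    finally show ?thesis
      using d_le[OF c] upper[of n] upper[of m] N[OF nm(1)] N[OF nm(2)] by linarith
  qed
  then show ?thesis by blast
qed

text \<open>Splitting the density \<open>D\<close> of \<open>N\<close> at a height \<open>k\<close> transfers the Cauchy property from \<open>L\<^sup>2(M)\<close> to \<open>N\<close>:
the part above \<open>k\<close> has small integral, and the rest contributes at most \<open>k \<integral> \<bar>a\<^sub>n - a\<^sub>m\<bar>\<close>.\<close>

lemma convergent_averages_absolutely_continuous:
  assumes "prob_space N" and sets: "sets N = sets M" and ac: "absolutely_continuous M N"
    and E: "E \<in> sets M"
  shows "convergent (\<lambda>n. (\<Sum>i<n. measure N ((S ^^ i) -` E \<inter> space M)) / real n)"
proof -
  interpret N: prob_space N by fact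
  have sp: "space N = space M" using sets by (rule sets_eq_imp_space_eq)
  define f where "f = (indicator E :: 'a \<Rightarrow> real)"
  let ?a = "orbit_average S f"
  have f [measurable]: "f \<in> borel_measurable M" using E by (auto simp: f_def)
  have f_bd: "\<bar>f x\<bar> \<le> 1" for x by (auto simp: f_def indicator_def)
  note a_bd = orbit_average_bounded[of f 1, OF f_bd]
  have a_N [measurable]: "?a n \<in> borel_measurable N" for n
    using orbit_average_measurable[OF f] by (simp add: measurable_cong_sets[OF sets refl])
  have a_int: "integrable N (?a n)" for n
    using a_bd by (intro N.integrable_const_bound[where B = 1]) auto
  have avg: "(\<Sum>i<n. measure N ((S ^^ i) -` E \<inter> space M)) / real n = (\<integral>x. ?a n x \<partial>N)" for n
  proof -
    have E': "(S ^^ i) -` E \<inter> space M \<in> sets N" for i using E sets by simp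
    have "(\<integral>x. f ((S ^^ i) x) \<partial>N) = measure N ((S ^^ i) -` E \<inter> space M)" for i
    proof -
      have "(\<integral>x. f ((S ^^ i) x) \<partial>N) = (\<integral>x. indicator ((S ^^ i) -` E \<inter> space M) x \<partial>N)"
        by (intro Bochner_Integration.integral_cong) (auto simp: f_def sp indicator_def)
      then show ?thesis using E' sets.sets_into_space[OF E'] by (simp add: Int_absorb2)
    qed
    moreover have "integrable N (\<lambda>x. f ((S ^^ i) x))" for i
    proof -
      have "(\<lambda>x. f ((S ^^ i) x)) \<in> borel_measurable M" by measurable
      then have "(\<lambda>x. f ((S ^^ i) x)) \<in> borel_measurable N"
        by (simp add: measurable_cong_sets[OF sets refl])
      then show ?thesis using f_bd by (intro N.integrable_const_bound[where B = 1]) auto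
    qed
    ultimately show ?thesis by (simp add: orbit_average_def Bochner_Integration.integral_sum)
  qed
  obtain D where D [measurable]: "D \<in> borel_measurable M"
    and RN: "AE x in M. RN_deriv M N x = ennreal (D x)" and D_nonneg: "\<And>x. 0 \<le> D x"
    using real_RN_deriv[OF N.finite_measure_axioms ac sets] by metis
  have "N = density M (RN_deriv M N)"
    using density_RN_deriv[OF ac sets] by simp
  also have "\<dots> = density M D" by (intro density_cong) (use RN in auto)
  finally have N_eq: "N = density M D" .
  have "integrable (density M D) (\<lambda>_. 1 :: real)"
    unfolding N_eq[symmetric] by (rule N.integrable_const)
  then have D_int: "integrable M D"
    using D_nonneg by (subst (asm) integrable_density) auto
  have "(\<lambda>k. \<integral>x. D x - min (D x) (real k) \<partial>M) \<longlonglongrightarrow> (\<integral>x. 0 \<partial>M)"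
  proof (rule integral_dominated_convergence[where w = D])
    have "(\<lambda>k. D x - min (D x) (real k)) \<longlonglongrightarrow> 0" for x
    proof (rule tendsto_eventually)
      obtain K :: nat where "D x \<le> real K" using real_arch_simple by blast
      then show "\<forall>\<^sub>F k in sequentially. D x - min (D x) (real k) = 0"
        by (intro eventually_mono[OF eventually_ge_at_top[of K]]) auto
    qed
    then show "AE x in M. (\<lambda>k. D x - min (D x) (real k)) \<longlonglongrightarrow> 0" by simp
  qed (use D_int D_nonneg in auto)
  then have tail: "(\<lambda>k. \<integral>x. D x - min (D x) (real k) \<partial>M) \<longlonglongrightarrow> 0" by simp
  have "Cauchy (\<lambda>n. \<integral>x. ?a n x \<partial>N)"
  proof (rule CauchyI)
    fix \<epsilon> :: real assume "0 < \<epsilon>"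
    have "eventually (\<lambda>k. (\<integral>x. D x - min (D x) (real k) \<partial>M) < \<epsilon> / 4) sequentially"
      using tail \<open>0 < \<epsilon>\<close> by (intro order_tendstoD) auto
    then obtain k where k: "(\<integral>x. D x - min (D x) (real k) \<partial>M) < \<epsilon> / 4"
      by (auto simp: eventually_sequentially)
    obtain K where K: "\<And>n m. n \<ge> K \<Longrightarrow> m \<ge> K \<Longrightarrow>
        (\<integral>x. (?a n x - ?a m x)\<^sup>2 \<partial>M) < \<epsilon>\<^sup>2 / (4 * (1 + (real k)\<^sup>2))"
      using mean_ergodic_Cauchy[OF f f_bd, of "\<epsilon>\<^sup>2 / (4 * (1 + (real k)\<^sup>2))"] \<open>0 < \<epsilon>\<close>
      by (auto simp: add_pos_nonneg)
    have "norm ((\<integral>x. ?a m x \<partial>N) - (\<integral>x. ?a n x \<partial>N)) < \<epsilon>" if mn: "m \<ge> K" "n \<ge> K" for m n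
    proof -
      let ?h = "\<lambda>x. ?a m x - ?a n x"
      have h_bd: "\<bar>?h x\<bar> \<le> 2" for x using a_bd[of m x] a_bd[of n x] by linarith
      have pt: "\<bar>D x * ?h x\<bar> \<le> 2 * (D x - min (D x) (real k)) + (\<epsilon> / 4 + (real k)\<^sup>2 / \<epsilon> * (?h x)\<^sup>2)" for x
      proof -
        \<comment> \<open>The weighted inequality \<open>k u \<le> \<epsilon> / 4 + k\<^sup>2 u\<^sup>2 / \<epsilon>\<close> takes the place of the bound of the \<open>L\<^sup>1\<close> norm by
            the \<open>L\<^sup>2\<close> norm.\<close>
        have "0 \<le> (\<epsilon> / 2 - real k * \<bar>?h x\<bar>)\<^sup>2" by simp
        then have "real k * \<bar>?h x\<bar> \<le> \<epsilon> / 4 + (real k)\<^sup>2 / \<epsilon> * (?h x)\<^sup>2"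
          using \<open>0 < \<epsilon>\<close> by (simp add: field_simps power2_eq_square)
        moreover have "min (D x) (real k) * \<bar>?h x\<bar> \<le> real k * \<bar>?h x\<bar>" by (intro mult_right_mono) auto
        moreover have "(D x - min (D x) (real k)) * \<bar>?h x\<bar> \<le> (D x - min (D x) (real k)) * 2"
          using h_bd by (intro mult_left_mono) auto
        moreover have "\<bar>D x * ?h x\<bar> = (D x - min (D x) (real k)) * \<bar>?h x\<bar> + min (D x) (real k) * \<bar>?h x\<bar>"
        proof -
          have "\<bar>D x * ?h x\<bar> = D x * \<bar>?h x\<bar>"
            by (simp only: abs_mult abs_of_nonneg[OF D_nonneg])
          then show ?thesis by (simp only: left_diff_distrib)
        qed
        ultimately show ?thesis by linarith
      qed
      have h_sq: "integrable M (\<lambda>x. (?h x)\<^sup>2)"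
        using h_bd by (intro integrable_square) auto
      have tr_int: "integrable M (\<lambda>x. D x - min (D x) (real k))"
        by (rule Bochner_Integration.integrable_bound[OF D_int]) (use D_nonneg in auto)
      have linear: "(\<integral>x. 2 * u x + (c + d * v x) \<partial>M) = 2 * (\<integral>x. u x \<partial>M) + (c + d * (\<integral>x. v x \<partial>M))"
        if "integrable M u" "integrable M v" for u v :: "'a \<Rightarrow> real" and c d
        using that by (simp add: prob_space)
      have "norm ((\<integral>x. ?a m x \<partial>N) - (\<integral>x. ?a n x \<partial>N)) = \<bar>\<integral>x. ?h x \<partial>N\<bar>"
        using a_int by simp
      also have "\<dots> = \<bar>\<integral>x. D x * ?h x \<partial>M\<bar>"
        unfolding N_eq using D_nonneg by (subst integral_density) auto
      also have "\<dots> \<le> (\<integral>x. \<bar>D x * ?h x\<bar> \<partial>M)" by (rule integral_abs_bound)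
      also have "\<dots> \<le> (\<integral>x. 2 * (D x - min (D x) (real k)) + (\<epsilon> / 4 + (real k)\<^sup>2 / \<epsilon> * (?h x)\<^sup>2) \<partial>M)"
        by (intro integral_mono' pt order_trans[OF abs_ge_zero pt] Bochner_Integration.integrable_add
            Bochner_Integration.integrable_mult_right tr_int h_sq) auto
      also have "\<dots> = 2 * (\<integral>x. D x - min (D x) (real k) \<partial>M) +
          (\<epsilon> / 4 + (real k)\<^sup>2 / \<epsilon> * (\<integral>x. (?h x)\<^sup>2 \<partial>M))"
        by (rule linear[OF tr_int h_sq])
      also have "(real k)\<^sup>2 / \<epsilon> * (\<integral>x. (?h x)\<^sup>2 \<partial>M) \<le> (real k)\<^sup>2 / \<epsilon> * (\<epsilon>\<^sup>2 / (4 * (1 + (real k)\<^sup>2)))"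
        using K[OF mn] \<open>0 < \<epsilon>\<close> by (intro mult_left_mono) auto
      also have "\<dots> \<le> \<epsilon> / 4"
      proof -
        have "0 < 1 + (real k)\<^sup>2" by (simp add: add_pos_nonneg)
        then show ?thesis using \<open>0 < \<epsilon>\<close> by (simp add: divide_simps power2_eq_square)
      qed
      finally show ?thesis using k by simp
    qed
    then show "\<exists>K. \<forall>m\<ge>K. \<forall>n\<ge>K. norm ((\<integral>x. ?a m x \<partial>N) - (\<integral>x. ?a n x \<partial>N)) < \<epsilon>" by blast
  qed
  then show ?thesis by (simp add: avg Cauchy_convergent_iff)
qed

end

section \<open>Complete codes are exhaustive\<close>

text \<open>Equality in Kraft's inequality. With \<open>N\<close> the length of \<open>u\<close> and \<open>q\<close> the size of the alphabet, a
codeword \<open>w\<close> has \<open>q\<^sup>N\<^sup>-\<^sup>|\<^sup>w\<^sup>|\<close> extensions of length \<open>N\<close>. Prefix-freeness makes these families disjoint, and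
completeness makes their sizes add up to \<open>q\<^sup>N\<close>, so that no word of length \<open>N\<close> is left out.\<close>

lemma complete_prefix_free_exhaustive:
  fixes L :: "'y::finite list set"
  assumes fin: "finite L" and pf: "prefix_free L" and complete: "complete_code L"
    and len: "\<And>w. w \<in> L \<Longrightarrow> length w \<le> length u"
  shows "\<exists>w\<in>L. \<exists>v. u = w @ v"
proof -
  let ?q = "CARD('y)" and ?N = "length u"
  define E where "E = (\<lambda>w. (\<lambda>v. w @ v) ` {v::'y list. length v = ?N - length w})"
  have card_words: "card {v::'y list. length v = n} = ?q ^ n" and
    fin_words: "finite {v::'y list. length v = n}" for n
    using card_lists_length_eq[of "UNIV::'y set" n] finite_lists_length_eq[of "UNIV::'y set" n] by auto
  have card_E: "card (E w) = ?q ^ (?N - length w)" for w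
    by (simp add: E_def card_image inj_on_def card_words)
  have disj: "E w \<inter> E w' = {}" if "w \<in> L" "w' \<in> L" "w \<noteq> w'" for w w'
  proof -
    have "w @ v \<noteq> w' @ v'" for v v'
    proof
      assume "w @ v = w' @ v'"
      then obtain s where "w = w' @ s \<or> w' = w @ s" by (auto simp: append_eq_append_conv2)
      then show False using pf that unfolding prefix_free_def by (metis append_Nil2)
    qed
    then show ?thesis by (auto simp: E_def)
  qed
  have "card (\<Union>w\<in>L. E w) = (\<Sum>w\<in>L. ?q ^ (?N - length w))"
  proof -
    have "finite (E w)" for w by (simp add: E_def fin_words)
    then show ?thesis using fin disj by (subst card_UN_disjoint) (auto simp: card_E)
  qed
  also have "real \<dots> = real ?q ^ ?N * (\<Sum>w\<in>L. 1 / real ?q ^ length w)"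
    unfolding of_nat_sum of_nat_power sum_distrib_left
    by (intro sum.cong refl) (simp add: len power_diff)
  also have "(\<Sum>w\<in>L. 1 / real ?q ^ length w) = 1"
    using complete has_sum_finite[OF fin] unfolding complete_code_def by (rule has_sum_unique[rotated])
  finally have "card (\<Union>w\<in>L. E w) = card {v::'y list. length v = ?N}"
    by (simp add: card_words flip: of_nat_power)
  then have "(\<Union>w\<in>L. E w) = {v. length v = ?N}"
    using len by (intro card_subset_eq fin_words) (auto simp: E_def)
  then have "u \<in> (\<Union>w\<in>L. E w)" by simp
  then show ?thesis by (auto simp: E_def)
qed

text \<open>Reversal exchanges prefixes and suffixes and preserves lengths.\<close>

lemma complete_suffix_free_exhaustive:
  fixes L :: "'y::finite list set"
  assumes fin: "finite L" and sf: "suffix_free L" and complete: "complete_code L"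
    and len: "\<And>w. w \<in> L \<Longrightarrow> length w \<le> length u"
  shows "\<exists>w\<in>L. \<exists>v. u = v @ w"
proof -
  have "prefix_free (rev ` L)"
    unfolding prefix_free_def
  proof (intro ballI allI impI notI)
    fix w z s assume "w \<in> rev ` L" "z \<in> rev ` L" "s \<noteq> []" "w = z @ s"
    then have "rev s @ rev z \<in> L" "rev z \<in> L" "rev s \<noteq> []" by (auto simp flip: rev_append)
    then show False using sf unfolding suffix_free_def by blast
  qed
  moreover have "complete_code (rev ` L)"
    using complete unfolding complete_code_def
    by (subst has_sum_reindex) (auto simp: o_def)
  moreover have "length w \<le> length (rev u)" if "w \<in> rev ` L" for w
    using that len by auto
  ultimately have "\<exists>w\<in>rev ` L. \<exists>v. rev u = w @ v"
    using fin by (intro complete_prefix_free_exhaustive) auto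
  then obtain w v where "w \<in> L" "rev u = rev w @ v" by blast
  then have "u = rev v @ w" by (metis rev_append rev_rev_ident)
  with \<open>w \<in> L\<close> show ?thesis by blast
qed

section \<open>Blocks of a concatenation\<close>

definition reads :: "('x \<Rightarrow> 'y list) \<Rightarrow> (int \<Rightarrow> 'y) \<Rightarrow> int \<Rightarrow> 'x \<Rightarrow> bool" where
  "reads f y k a \<longleftrightarrow> (\<forall>j<length (f a). y (k + int j) = f a ! j)"

lemma reads_translate: "reads f (\<lambda>i. y (i + n)) k a \<longleftrightarrow> reads f y (k + n) a"
  by (simp add: reads_def algebra_simps)

lemma block_start_1 [simp]: "block_start f x 1 = 1"
  by (simp add: block_start_def)

lemma block_start_step: "block_start f x (i + 1) = block_start f x i + int (length (f (x i)))"
proof (cases "1 \<le> i")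
  case True
  then have "{1..<i + 1} = insert i {1..<i}" by auto
  with True show ?thesis by (simp add: block_start_def)
next
  case False
  then have "{i..0} = insert i {i + 1..0}" by auto
  with False show ?thesis by (simp add: block_start_def)
qed

section \<open>Decoding two-sided sequences\<close>

locale complete_fix_free_code =
  fixes f :: "'x::finite \<Rightarrow> 'y::finite list"
  assumes complete_fix_free: "complete_fix_free f"
    and nontrivial: "range f \<noteq> {[]}"
begin

lemma prefix_code: "f b = f a @ s \<Longrightarrow> a = b" and suffix_code: "f b = s @ f a \<Longrightarrow> a = b"
proof -
  have inj: "inj f" and pf: "prefix_free (range f)" and sf: "suffix_free (range f)"
    using complete_fix_free by (auto simp: complete_fix_free_def fix_free_def)
  show "a = b" if "f b = f a @ s"
    using pf that injD[OF inj, of b a] by (cases "s = []") (auto simp: prefix_free_def)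
  show "a = b" if "f b = s @ f a"
    using sf that injD[OF inj, of b a] by (cases "s = []") (auto simp: suffix_free_def)
qed

text \<open>The empty word is a prefix of every word, so a prefix-free code that contains it has no other
element.\<close>

lemma length_pos: "0 < length (f a)"
proof (rule ccontr)
  assume "\<not> 0 < length (f a)"
  then have "f a = []" by simp
  then have "f b = []" for b using prefix_code[of b a "f b"] by simp
  then have "range f = {[]}" by auto
  with nontrivial show False by simp
qed

lemma reads_prefix_unique:
  assumes "reads f y k a" "reads f y k b"
  shows "a = b"
proof -
  have *: "a = b" if "reads f y k a" "reads f y k b" "length (f a) \<le> length (f b)" for a b
  proof -
    have "take (length (f a)) (f b) = f a"
      using that by (intro nth_equalityI) (auto simp: reads_def)
    then have "f b = f a @ drop (length (f a)) (f b)" by (metis append_take_drop_id)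
    then show ?thesis by (rule prefix_code)
  qed
  show ?thesis using *[of a b] *[of b a] assms by (cases "length (f a) \<le> length (f b)") auto
qed

lemma reads_suffix_unique:
  assumes "reads f y (k - int (length (f a))) a" "reads f y (k - int (length (f b))) b"
  shows "a = b"
proof -
  have *: "a = b"
    if a: "reads f y (k - int (length (f a))) a" and b: "reads f y (k - int (length (f b))) b"
      and le: "length (f a) \<le> length (f b)" for a b
  proof -
    let ?d = "length (f b) - length (f a)"
    have "drop ?d (f b) = f a"
    proof (rule nth_equalityI)
      fix j assume "j < length (drop ?d (f b))"
      then have j: "j < length (f a)" "?d + j < length (f b)" using le by auto
      have "f b ! (?d + j) = y (k - int (length (f b)) + int (?d + j))"
        using b j(2) unfolding reads_def by metis
      also have "k - int (length (f b)) + int (?d + j) = k - int (length (f a)) + int j"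
        using le by simp
      finally show "drop ?d (f b) ! j = f a ! j" using a le j by (simp add: reads_def)
    qed (use le in auto)
    then have "f b = take ?d (f b) @ f a" by (metis append_take_drop_id)
    then show ?thesis by (rule suffix_code)
  qed
  show ?thesis using *[of a b] *[of b a] assms by (cases "length (f a) \<le> length (f b)") auto
qed

definition max_length :: nat where "max_length = Max (range (length \<circ> f))"

lemma length_le_max: "length (f a) \<le> max_length"
  unfolding max_length_def by (intro Max_ge) auto

lemma ex_first_word: "\<exists>a. reads f y 1 a"
proof -
  let ?u = "map (\<lambda>j. y (1 + int j)) [0..<max_length]"
  have "\<exists>w\<in>range f. \<exists>v. ?u = w @ v"
    using complete_fix_free length_le_max
    by (intro complete_prefix_free_exhaustive) (auto simp: complete_fix_free_def fix_free_def)
  then obtain a v where u: "?u = f a @ v" by auto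
  have "y (1 + int j) = f a ! j" if "j < length (f a)" for j
    using arg_cong[OF u, of "\<lambda>w. w ! j"] that length_le_max[of a] by (simp add: nth_append)
  then show ?thesis by (auto simp: reads_def)
qed

lemma ex_last_word: "\<exists>a. reads f y (1 - int (length (f a))) a"
proof -
  let ?N = max_length
  let ?u = "map (\<lambda>j. y (1 - int ?N + int j)) [0..<?N]"
  have "\<exists>w\<in>range f. \<exists>v. ?u = v @ w"
    using complete_fix_free length_le_max
    by (intro complete_suffix_free_exhaustive) (auto simp: complete_fix_free_def fix_free_def)
  then obtain a v where u: "?u = v @ f a" by auto
  have N: "?N = length v + length (f a)" using arg_cong[OF u, of length] by simp
  have "y (1 - int (length (f a)) + int j) = f a ! j" if "j < length (f a)" for j
    using arg_cong[OF u, of "\<lambda>w. w ! (length v + j)"] that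
    by (simp add: nth_append N algebra_simps)
  then show ?thesis by (auto simp: reads_def)
qed

definition first_word :: "(int \<Rightarrow> 'y) \<Rightarrow> 'x" where
  "first_word y = (THE a. reads f y 1 a)"

definition last_word :: "(int \<Rightarrow> 'y) \<Rightarrow> 'x" where
  "last_word y = (THE a. reads f y (1 - int (length (f a))) a)"

lemma first_word_eq_iff: "first_word y = a \<longleftrightarrow> reads f y 1 a"
  using theI'[of "\<lambda>a. reads f y 1 a"] ex_first_word[of y] reads_prefix_unique[of y 1]
  unfolding first_word_def by blast

lemma last_word_eq_iff: "last_word y = a \<longleftrightarrow> reads f y (1 - int (length (f a))) a"
  using theI'[of "\<lambda>a. reads f y (1 - int (length (f a))) a"] ex_last_word[of y]
    reads_suffix_unique[of y 1]
  unfolding last_word_def by blast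

text \<open>In terms of code sequences, the shift of the decoded sequence and its inverse move the origin over one
codeword, to the right and to the left. The amounts depend on the sequence.\<close>

definition next_word :: "(int \<Rightarrow> 'y) \<Rightarrow> int \<Rightarrow> 'y" where
  "next_word y = (\<lambda>i. y (i + int (length (f (first_word y)))))"

definition prev_word :: "(int \<Rightarrow> 'y) \<Rightarrow> int \<Rightarrow> 'y" where
  "prev_word y = (\<lambda>i. y (i + - int (length (f (last_word y)))))"

text \<open>The word that begins after the origin is the word that ends at the origin after it has been
skipped. Invertibility and measure preservation of \<^term>\<open>next_word\<close> both rest on this.\<close>

lemma last_word_translate:
  "last_word (\<lambda>i. y (i + int (length (f a)))) = a \<longleftrightarrow> first_word y = a"
  by (simp add: last_word_eq_iff first_word_eq_iff reads_translate)

lemma prev_word_next_word: "prev_word (next_word y) = y"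
proof -
  have "last_word (next_word y) = first_word y"
    by (simp add: next_word_def last_word_translate)
  then show ?thesis by (simp add: prev_word_def next_word_def)
qed

lemma next_word_prev_word: "next_word (prev_word y) = y"
proof -
  have "reads f y (1 - int (length (f (last_word y)))) (last_word y)"
    by (simp flip: last_word_eq_iff)
  then have "first_word (prev_word y) = last_word y"
    unfolding first_word_eq_iff prev_word_def reads_translate by simp
  then show ?thesis by (simp add: prev_word_def next_word_def)
qed

text \<open>The orbit under integer powers of \<^term>\<open>next_word\<close>. It starts at index 1, because block 1 is the one
that starts at coordinate 1.\<close>

definition word_orbit :: "(int \<Rightarrow> 'y) \<Rightarrow> int \<Rightarrow> int \<Rightarrow> 'y" where
  "word_orbit y i =
    (if 1 \<le> i then (next_word ^^ nat (i - 1)) y else (prev_word ^^ nat (1 - i)) y)"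

lemma word_orbit_1 [simp]: "word_orbit y 1 = y"
  by (simp add: word_orbit_def)

lemma word_orbit_step: "word_orbit y (i + 1) = next_word (word_orbit y i)"
proof (cases "1 \<le> i")
  case True
  then have "nat (i + 1 - 1) = Suc (nat (i - 1))" by simp
  with True show ?thesis by (simp add: word_orbit_def)
next
  case False
  then have "nat (1 - i) = Suc (nat (- i))" by simp
  with False show ?thesis by (auto simp: word_orbit_def next_word_prev_word)
qed

lemma word_orbit_next_word: "word_orbit (next_word y) i = word_orbit y (i + 1)"
proof (cases "1 \<le> i")
  case True
  then have "nat (i + 1 - 1) = Suc (nat (i - 1))" by simp
  with True show ?thesis by (simp add: word_orbit_def funpow_swap1)
next
  case False
  then have "nat (1 - i) = Suc (nat (- i))" by simp
  with False show ?thesis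
    by (auto simp: word_orbit_def prev_word_next_word funpow_Suc_right simp del: funpow.simps(2))
qed

definition decode :: "(int \<Rightarrow> 'y) \<Rightarrow> int \<Rightarrow> 'x" where
  "decode y i = first_word (word_orbit y i)"

lemma seq_shift_decode: "seq_shift (decode y) = decode (next_word y)"
  by (rule ext) (simp add: seq_shift_def decode_def word_orbit_next_word)

lemma seq_shift_funpow_decode: "(seq_shift ^^ n) (decode y) = decode ((next_word ^^ n) y)"
  by (induction n) (auto simp: seq_shift_decode)

text \<open>The lengths of the words skipped on the way to block \<open>i\<close> add up to \<^term>\<open>block_start f (decode y) i\<close>,
up to the offset 1 of the first block. On both sides of the origin this follows from the recursion
for block starts, forwards or backwards.\<close>

lemma word_orbit_eq_translate:
  "word_orbit y i = (\<lambda>k. y (k + (block_start f (decode y) i - 1)))"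
proof (induction i rule: int_induct[where k = 1])
  case base
  show ?case by simp
next
  case (step1 i)
  have "word_orbit y (i + 1) = (\<lambda>k. word_orbit y i (k + int (length (f (decode y i)))))"
    by (simp add: word_orbit_step next_word_def decode_def)
  then show ?case unfolding step1(2) block_start_step by (simp add: algebra_simps)
next
  case (step2 i)
  have "word_orbit y i = (\<lambda>k. word_orbit y (i - 1) (k + int (length (f (decode y (i - 1))))))"
    using word_orbit_step[of y "i - 1"] by (simp add: next_word_def decode_def)
  then have "word_orbit y (i - 1) k = word_orbit y i (k - int (length (f (decode y (i - 1)))))" for k
    by simp
  then show ?case
    using step2 block_start_step[of f "decode y" "i - 1"] by (simp add: algebra_simps)
qed

lemma reads_decode: "reads f y (block_start f (decode y) i) (decode y i)"
proof -
  have "reads f (word_orbit y i) 1 (decode y i)"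
    by (simp add: decode_def flip: first_word_eq_iff)
  then show ?thesis by (simp add: word_orbit_eq_translate reads_translate)
qed

text \<open>The origin is a block boundary of both parsings. To its right they agree by prefix-freeness, to
its left by suffix-freeness.\<close>

lemma parse_unique:
  assumes x: "\<And>i. reads f y (block_start f x i) (x i)"
    and z: "\<And>i. reads f y (block_start f z i) (z i)"
  shows "x = z"
proof -
  have "block_start f x i = block_start f z i" for i
  proof (induction i rule: int_induct[where k = 1])
    case base
    show ?case by simp
  next
    case (step1 i)
    then have "x i = z i" using x[of i] z[of i] by (intro reads_prefix_unique) auto
    then show ?case using step1 by (simp add: block_start_step)
  next
    case (step2 i)
    have "block_start f v (i - 1) = block_start f v i - int (length (f (v (i - 1))))" for v
      using block_start_step[of f v "i - 1"] by simp
    moreover from this have "x (i - 1) = z (i - 1)"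
      using x[of "i - 1"] z[of "i - 1"] step2
      by (intro reads_suffix_unique[of y "block_start f x i"]) auto
    ultimately show ?case using step2 by simp
  qed
  then show ?thesis using x z by (intro ext reads_prefix_unique) auto
qed

lemma block_start_mono: "i \<le> j \<Longrightarrow> block_start f x i \<le> block_start f x j"
proof (induction j rule: int_ge_induct)
  case (step j)
  then show ?case by (simp add: block_start_step)
qed simp

text \<open>Codewords are nonempty, so that blocks cover every coordinate: moving by one coordinate leads at
most to the neighbouring block.\<close>

lemma ex_block: "\<exists>i. block_start f x i \<le> k \<and> k < block_start f x (i + 1)"
proof (induction k rule: int_induct[where k = 1])
  case base
  show ?case using length_pos by (intro exI[of _ 1]) (simp only: block_start_step, simp)
next
  case (step1 k)
  then obtain i where i: "block_start f x i \<le> k" "k < block_start f x (i + 1)" by blast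
  show ?case
  proof (cases "k + 1 < block_start f x (i + 1)")
    case True
    with i show ?thesis by (intro exI[of _ i]) auto
  next
    case False
    with i show ?thesis
      using block_start_step[of f x "i + 1"] length_pos[of "x (i + 1)"]
      by (intro exI[of _ "i + 1"]) linarith
  qed
next
  case (step2 k)
  then obtain i where i: "block_start f x i \<le> k" "k < block_start f x (i + 1)" by blast
  show ?case
  proof (cases "block_start f x i \<le> k - 1")
    case True
    with i show ?thesis by (intro exI[of _ i]) auto
  next
    case False
    with i have "block_start f x (i - 1) \<le> k - 1" "k - 1 < block_start f x (i - 1 + 1)"
      using block_start_step[of f x "i - 1"] length_pos[of "x (i - 1)"] by auto
    then show ?thesis by blast
  qed
qed

lemma concat_eq:
  assumes "block_start f x i \<le> k" "k < block_start f x (i + 1)"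
  shows "concat_two_sided f x k = f (x i) ! nat (k - block_start f x i)"
proof -
  have "(THE i. block_start f x i \<le> k \<and> k < block_start f x (i + 1)) = i"
  proof (rule the_equality)
    fix j assume j: "block_start f x j \<le> k \<and> k < block_start f x (j + 1)"
    show "j = i"
      using assms j block_start_mono[of "i + 1" j x] block_start_mono[of "j + 1" i x] by linarith
  qed (use assms in simp)
  then show ?thesis by (simp add: concat_two_sided_def)
qed

lemma reads_concat: "reads f (concat_two_sided f x) (block_start f x i) (x i)"
  by (auto simp: reads_def block_start_step concat_eq[of x i])

lemma concat_decode: "concat_two_sided f (decode y) = y"
proof
  fix k
  obtain i where i: "block_start f (decode y) i \<le> k" "k < block_start f (decode y) (i + 1)"
    using ex_block by blast
  define j where "j = nat (k - block_start f (decode y) i)"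
  have k: "k = block_start f (decode y) i + int j" using i(1) by (simp add: j_def)
  then have "j < length (f (decode y i))" using i(2) by (simp add: block_start_step)
  then have "y k = f (decode y i) ! j" using reads_decode[of y i] by (simp add: reads_def k)
  then show "concat_two_sided f (decode y) k = y k" by (simp add: concat_eq[OF i] j_def)
qed

lemma decode_concat: "decode (concat_two_sided f x) = x"
  using reads_decode reads_concat by (rule parse_unique)

lemma image_concat: "concat_two_sided f ` A = decode -` A"
  using concat_decode decode_concat by (auto simp: image_iff) metis

lemma sets_reads: "{y. reads f y k a} \<in> sets seq_space"
proof -
  have "{y. reads f y k a} = (\<Inter>j\<in>{..<length (f a)}. (\<lambda>y. y (k + int j)) -` {f a ! j})"
    by (auto simp: reads_def)
  also have "\<dots> \<in> sets seq_space"
    using length_pos[of a] measurable_sets[OF measurable_coordinate]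
    by (intro sets.finite_INT) auto
  finally show ?thesis .
qed

lemma measurable_first_word: "first_word \<in> measurable seq_space (count_space UNIV)"
  and measurable_last_word: "last_word \<in> measurable seq_space (count_space UNIV)"
  using sets_reads
  by (auto simp: measurable_count_space_eq2 vimage_def first_word_eq_iff last_word_eq_iff)

lemma measurable_next_word: "next_word \<in> measurable seq_space seq_space"
proof -
  have "(\<lambda>y. (\<lambda>a y i. y (i + int (length (f a)))) (first_word y) y) \<in> measurable seq_space seq_space"
    by (rule measurable_compose_countable[OF measurable_translate measurable_first_word])
  then show ?thesis by (simp add: next_word_def[abs_def])
qed

lemma measurable_prev_word: "prev_word \<in> measurable seq_space seq_space"
proof -
  have "(\<lambda>y. (\<lambda>a y i. y (i + - int (length (f a)))) (last_word y) y) \<in> measurable seq_space seq_space"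
    by (rule measurable_compose_countable[OF measurable_translate measurable_last_word])
  then show ?thesis by (simp add: prev_word_def[abs_def])
qed

lemma measurable_decode: "decode \<in> measurable seq_space seq_space"
proof (rule measurable_seq_spaceI)
  fix i
  have "(\<lambda>y. word_orbit y i) \<in> measurable seq_space seq_space"
    unfolding word_orbit_def
    by (cases "1 \<le> i") (simp_all add: measurable_compose_n measurable_next_word measurable_prev_word)
  then show "(\<lambda>y. decode y i) \<in> measurable seq_space (count_space UNIV)"
    unfolding decode_def by (rule measurable_compose[OF _ measurable_first_word])
qed

section \<open>Transporting measures through the code\<close>

text \<open>The image of a set under the concatenation is its preimage under decoding, so that the set function
in the definition of \<^const>\<open>comp_concat\<close> is the measure induced by a measurable map.\<close>

lemma comp_concat_eq_distr:
  assumes "sets M = sets seq_space"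
  shows "comp_concat M f = distr M seq_space decode"
proof -
  have [measurable]: "decode \<in> measurable M seq_space"
    using measurable_decode assms by (simp cong: measurable_cong_sets)
  have sp: "space M = UNIV" using sets_eq_imp_space_eq[OF assms] by simp
  have "measure_of (space seq_space) (sets seq_space) (\<lambda>A. emeasure M (concat_two_sided f ` A)) =
      measure_of (space seq_space) (sets seq_space) (emeasure (distr M seq_space decode))"
    by (rule measure_of_eq[OF sets.space_closed])
       (simp add: sets.sigma_sets_eq[of seq_space, simplified] emeasure_distr image_concat sp)
  also have "\<dots> = distr M seq_space decode"
    using measure_of_of_measure[of "distr M seq_space decode"] by simp
  finally show ?thesis by (simp only: comp_concat_def)
qed

text \<open>Although \<^term>\<open>next_word\<close> moves different sequences by different amounts, it preserves every
translation invariant measure: the part of the preimage of \<open>A\<close> on which the codeword \<open>a\<close> is skipped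
is the translate of the part of \<open>A\<close> whose last word is \<open>a\<close>, and the latter parts partition \<open>A\<close>.\<close>

lemma measure_preserving_next_word:
  assumes "prob_space M" and sets: "sets M = sets seq_space"
    and inv: "\<And>A k. A \<in> sets M \<Longrightarrow> measure M ((\<lambda>x i. x (i + k)) -` A) = measure M A"
  shows "measure_preserving M next_word"
proof -
  interpret prob_space M by fact
  have sp: "space M = UNIV" using sets_eq_imp_space_eq[OF sets] by simp
  have next_meas: "next_word \<in> measurable M M"
    using measurable_next_word sets by (simp cong: measurable_cong_sets)
  have last_sets: "last_word -` {a} \<in> sets M" for a
    using measurable_sets[OF measurable_last_word, of "{a}"] sets by simp
  have vim: "(\<lambda>x i. x (i + k)) -` A \<in> sets M" if "A \<in> sets M" for k A
    using measurable_sets[OF measurable_translate, of A k] that sets by simp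
  have "measure M (next_word -` A) = measure M A" if A: "A \<in> sets M" for A
  proof -
    let ?t = "\<lambda>a (y::int \<Rightarrow> 'y) i. y (i + int (length (f a)))"
    let ?P = "\<lambda>a. last_word -` {a} \<inter> A"
    have P: "?P a \<in> sets M" for a using last_sets A by auto
    have "next_word -` A = (\<Union>a. ?t a -` ?P a)"
      by (auto simp: last_word_translate next_word_def)
    also have "measure M \<dots> = (\<Sum>a\<in>UNIV. measure M (?t a -` ?P a))"
      using vim[OF P] by (intro finite_measure_finite_Union)
        (auto simp: disjoint_family_on_def last_word_translate)
    also have "\<dots> = (\<Sum>a\<in>UNIV. measure M (?P a))" by (intro sum.cong refl inv P)
    also have "\<dots> = measure M (\<Union>a. ?P a)"
      using P by (intro finite_measure_finite_Union[symmetric]) (auto simp: disjoint_family_on_def)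
    also have "(\<Union>a. ?P a) = A" by auto
    finally show ?thesis .
  qed
  then have "distr M M next_word = M"
    using next_meas by (intro measure_eqI) (auto simp: emeasure_distr sp emeasure_eq_measure)
  then show ?thesis
    using next_meas by unfold_locales
qed

end

theorem corollary4p2:
  fixes f :: "'x::finite \<Rightarrow> 'y::finite list"
    and \<nu> :: "(int \<Rightarrow> 'y) measure"
  assumes "complete_fix_free f"
    and "range f \<noteq> {[]}"
    and "prob_space \<nu>"
    and "sets \<nu> = sets seq_space"
    and "AMS \<nu>"
  shows "prob_space (comp_concat \<nu> f)
    \<and> AMS (comp_concat \<nu> f)
    \<and> prob_space (stationary_mean (comp_concat \<nu> f))
    \<and> absolutely_continuous (comp_concat (stationary_mean \<nu>) f)
        (stationary_mean (comp_concat \<nu> f))"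
proof -
  interpret complete_fix_free_code f by unfold_locales fact+
  interpret \<nu>: prob_space \<nu> by fact
  have space_\<nu>: "space \<nu> = UNIV" using sets_eq_imp_space_eq[OF assms(4)] by simp
  define m where "m = stationary_mean \<nu>"
  have sets_m: "sets m = sets \<nu>" by (simp add: m_def)
  have space_m: "space m = UNIV" using space_\<nu> by (simp add: m_def)
  interpret m: measure_preserving m next_word
    using assms(3-5) unfolding m_def
    by (intro measure_preserving_next_word prob_space_stationary_mean
        measure_stationary_mean_translate) auto
  have \<nu>_ac: "absolutely_continuous m \<nu>"
    unfolding m_def using assms(3-5) by (rule absolutely_continuous_stationary_mean)
  have decode_\<nu>: "decode \<in> measurable \<nu> seq_space"
    using measurable_decode assms(4) by (simp cong: measurable_cong_sets)
  have decode_m: "decode \<in> measurable m seq_space"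
    using decode_\<nu> by (simp cong: measurable_cong_sets add: sets_m)
  define \<mu> where "\<mu> = comp_concat \<nu> f"
  have \<mu>_eq: "\<mu> = distr \<nu> seq_space decode"
    unfolding \<mu>_def by (rule comp_concat_eq_distr) fact
  have sets_\<mu>: "sets \<mu> = sets seq_space" by (simp add: \<mu>_eq)
  have prob_\<mu>: "prob_space \<mu>" unfolding \<mu>_eq by (rule \<nu>.prob_space_distr) fact
  have decode_sets: "decode -` A \<in> sets m" if "A \<in> sets seq_space" for A
    using measurable_sets[OF decode_m that] by (simp add: space_m)
  have avg: "shift_average \<mu> A n =
      (\<Sum>i<n. measure \<nu> ((next_word ^^ i) -` (decode -` A) \<inter> space m)) / real n"
    if A: "A \<in> sets seq_space" for A n
  proof -
    have "measure \<mu> ((seq_shift ^^ i) -` A) = measure \<nu> ((next_word ^^ i) -` (decode -` A))" for i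
    proof -
      have "measure \<mu> ((seq_shift ^^ i) -` A) = measure \<nu> (decode -` ((seq_shift ^^ i) -` A))"
        using seq_shift_funpow_vimage_sets[OF refl A, of i] unfolding \<mu>_eq
        by (simp add: measure_distr[OF decode_\<nu>] space_\<nu>)
      also have "decode -` ((seq_shift ^^ i) -` A) = (next_word ^^ i) -` (decode -` A)"
        by (simp add: vimage_def seq_shift_funpow_decode)
      finally show ?thesis .
    qed
    then show ?thesis by (simp add: shift_average_def space_m \<mu>_eq)
  qed
  have AMS_\<mu>: "AMS \<mu>"
    unfolding AMS_def
  proof
    fix A assume "A \<in> sets \<mu>"
    then have A: "A \<in> sets seq_space" by (simp add: sets_\<mu>)
    show "convergent (shift_average \<mu> A)"
      using m.convergent_averages_absolutely_continuous[OF assms(3) sets_m[symmetric] \<nu>_ac decode_sets[OF A]]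
      by (simp add: avg[OF A, abs_def])
  qed
  \<comment> \<open>A null set of the invariant measure keeps null preimages along the orbit, so that even the averages
      vanish on it.\<close>
  have "absolutely_continuous (comp_concat m f) (stationary_mean \<mu>)"
    unfolding absolutely_continuous_def
  proof
    fix A assume null: "A \<in> null_sets (comp_concat m f)"
    have m_eq: "comp_concat m f = distr m seq_space decode"
      using sets_m assms(4) by (intro comp_concat_eq_distr) simp
    have A: "A \<in> sets seq_space" using null by (auto simp: m_eq)
    have "decode -` A \<in> null_sets m"
      using null decode_sets[OF A]
      by (auto simp: m_eq null_sets_def emeasure_distr[OF decode_m] space_m)
    then have "(next_word ^^ i) -` (decode -` A) \<inter> space m \<in> null_sets m" for i
      using emeasure_distr[OF m.S_funpow_measurable, of "decode -` A" i] decode_sets[OF A]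
        measurable_sets[OF m.S_funpow_measurable decode_sets[OF A], of i]
      by (auto simp: null_sets_def m.distr_S_funpow)
    then have "(next_word ^^ i) -` (decode -` A) \<inter> space m \<in> null_sets \<nu>" for i
      using \<nu>_ac by (auto simp: absolutely_continuous_def)
    then have "shift_average \<mu> A n = 0" for n
      by (simp add: avg[OF A] measure_eq_0_null_sets)
    then have "shift_average \<mu> A = (\<lambda>_. 0)" by blast
    then have "shift_average \<mu> A \<longlonglongrightarrow> 0" by simp
    then have zero: "measure (stationary_mean \<mu>) A = 0"
      using shift_average_LIMSEQ_stationary_mean[OF prob_\<mu> sets_\<mu> AMS_\<mu>] A sets_\<mu>
      by (intro LIMSEQ_unique) auto
    interpret prob_space "stationary_mean \<mu>"
      by (rule prob_space_stationary_mean) fact+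
    show "A \<in> null_sets (stationary_mean \<mu>)"
      using A sets_\<mu> zero by (simp add: null_sets_def emeasure_eq_measure)
  qed
  then show ?thesis
    using prob_\<mu> AMS_\<mu> prob_space_stationary_mean[OF prob_\<mu> sets_\<mu> AMS_\<mu>]
    by (simp add: \<mu>_def m_def)
qed

end
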